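(* Let $G$ be a nontrivial cyclic group of order $n$, let $S$ be the set of all generators of $G$, and let $\Gamma(G)$ be the generator graph of $G$. Then the Gutman index of $\Gamma(G)$ is $$Gut(\Gamma(G)) = \tfrac{1}{2}|S|(|S|-1)(n-1)^2 + |S|^2(n-|S|)(2n-|S|-2).$$
   Context: For a group $G$, the generator graph $\Gamma(G)$ is the simple undirected graph whose vertex set is the set of elements of $G$, in which two distinct elements $x,y$ are adjacent if and only if at least one of them generates $G$ (i.e. $\langle x\rangle = G$ or $\langle y\rangle = G$). For a connected graph $\Gamma$, the Gutman index is $Gut(\Gamma) = \sum_{\{u,v\}\subseteq V(\Gamma)} \deg_\Gamma(u)\deg_\Gamma(v)\, d_\Gamma(u,v)$, summing over unordered pairs of distinct vertices, where $d_\Gamma$ is the graph distance. *)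

theory Defs
  imports
    "HOL-Algebra.Elementary_Groups"
    "Graph_Theory.Pair_Digraph"
    "Graph_Theory.Shortest_Path"
begin

definition generators :: "('a, 'b) monoid_scheme \<Rightarrow> 'a set" where
  "generators G = {x \<in> carrier G. generate G {x} = carrier G}"

text \<open>An undirected graph is represented by the
  symmetric digraph with one arc in each direction per edge. Simple undirected graphs
  are thus the instances of \<^locale>\<open>pair_graph\<close> (finite) or
  \<^locale>\<open>pair_bidirected_digraph\<close> (arbitrary).\<close>

definition generator_graph :: "('a, 'b) monoid_scheme \<Rightarrow> 'a pair_pre_digraph" where
  "generator_graph G =
    \<lparr> pverts = carrier G,
      parcs = {(x, y). x \<in> carrier G \<and> y \<in> carrier G \<and> x \<noteq> y \<and>
                 (generate G {x} = carrier G \<or> generate G {y} = carrier G)} \<rparr>"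

text \<open>Every edge at \<open>v\<close> contributes exactly one outgoing arc.\<close>

definition degree :: "'a pair_pre_digraph \<Rightarrow> 'a \<Rightarrow> nat" where
  "degree \<Gamma> v = out_degree (with_proj \<Gamma>) v"

text \<open>The least number of arcs of a walk from \<open>u\<close> to \<open>v\<close>; it is \<open>\<infinity>\<close> if there is no such walk.\<close>

definition distance :: "'a pair_pre_digraph \<Rightarrow> 'a \<Rightarrow> 'a \<Rightarrow> ereal" where
  "distance \<Gamma> u v = wf_digraph.\<mu> (with_proj \<Gamma>) (\<lambda>_. 1) u v"

text \<open>The sum runs over the unordered pairs \<open>e = {u, v}\<close> of distinct vertices. The description
  operator picks the summand, which does not depend on the order in which the two elements
  of \<open>e\<close> are named (see \<open>gutman_summand\<close> below).\<close>

definition gutman_index :: "'a pair_pre_digraph \<Rightarrow> ereal" where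
  "gutman_index \<Gamma> =
    (\<Sum>e \<in> {e. e \<subseteq> pverts \<Gamma> \<and> card e = 2}.
       THE c. \<exists>u v. e = {u, v} \<and> c = ereal (degree \<Gamma> u * degree \<Gamma> v) * distance \<Gamma> u v)"

lemma pair_bidirected_generator_graph: "pair_bidirected_digraph (generator_graph G)"
proof
  show "symmetric (with_proj (generator_graph G))"
    unfolding symmetric_def with_proj_simps by (rule symI) (simp add: generator_graph_def; blast)
qed (simp_all add: generator_graph_def split_beta)

lemma (in pair_sym_digraph) distance_commute: "distance G u v = distance G v u"
proof -
  have len: "awalk_cost (\<lambda>_. 1) p = real (length p)" for p :: "('a \<times> 'a) awalk"
    by (induction p) auto
  have len_rev: "length (rev_path p) = length p" for p :: "('a \<times> 'a) awalk"
    by (induction p) auto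
  have le: "distance G u v \<le> distance G v u" for u v
    unfolding distance_def \<mu>_def
  proof (rule INF_greatest)
    fix p assume "p \<in> {p. awalk v p u}"
    then have "rev_path p \<in> {p. awalk u p v}"
      by simp
    then have "(INF p\<in>{p. awalk u p v}. ereal (awalk_cost (\<lambda>_. 1) p))
        \<le> ereal (awalk_cost (\<lambda>_. 1) (rev_path p))"
      by (rule INF_lower)
    also have "\<dots> = ereal (awalk_cost (\<lambda>_. 1) p)"
      by (simp add: len len_rev)
    finally show "(INF p\<in>{p. awalk u p v}. ereal (awalk_cost (\<lambda>_. 1) p))
        \<le> ereal (awalk_cost (\<lambda>_. 1) p)" .
  qed
  show ?thesis
    by (rule antisym) (rule le)+
qed

lemma (in pair_sym_digraph) gutman_summand:
  "(THE c. \<exists>u' v'. {u, v} = {u', v'} \<and> c = ereal (degree G u' * degree G v') * distance G u' v')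
    = ereal (degree G u * degree G v) * distance G u v" (is "(THE c. ?P c) = ?c")
proof (rule the_equality)
  show "?P ?c"
    by blast
next
  fix c assume "?P c"
  then obtain u' v' where uv: "{u, v} = {u', v'}"
    and c: "c = ereal (degree G u' * degree G v') * distance G u' v'"
    by blast
  from uv consider "u' = u" "v' = v" | "u' = v" "v' = u"
    by (auto simp only: doubleton_eq_iff)
  then show "c = ?c"
  proof cases
    case 1
    then show ?thesis
      by (simp only: c)
  next
    case 2
    then show ?thesis
      by (simp only: c distance_commute[of v u] mult.commute[of "degree G v"])
  qed
qed

end

theory Submission
  imports Defs
begin

text \<open>A generator is adjacent to every other vertex, and a non-generator exactly to the
  generators. So generators have degree \<open>n - 1\<close> and are at distance \<open>1\<close> from everything else,
  while non-generators have degree \<open>|S|\<close> and, as \<open>S\<close> is nonempty, are at distance \<open>2\<close> from one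
  another. The formula adds up the pairs inside \<open>S\<close>, across, and outside \<open>S\<close>.\<close>

text \<open>Real subtraction avoids truncation: at \<open>m = 0\<close> the factor
  \<open>real m\<close> kills the product.\<close>

lemma real_choose_two: "real (m choose 2) = real m * (real m - 1) / 2"
proof (induction m)
  case (Suc m)
  have "Suc m choose 2 = m + (m choose 2)"
    by (simp add: numeral_2_eq_2)
  with Suc show ?case
    by (simp add: field_simps)
qed simp

text \<open>A mixed pair has a unique element on each side, so \<open>A \<times> B\<close> lists
  every such pair exactly once and the double sum carries no factor 1/2.\<close>

lemma sum_pairs_Un_disjoint:
  fixes f :: "'a set \<Rightarrow> 'b::comm_monoid_add"
  assumes "finite A" "finite B" "A \<inter> B = {}"
  shows "(\<Sum>e | e \<subseteq> A \<union> B \<and> card e = 2. f e) =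
    (\<Sum>e | e \<subseteq> A \<and> card e = 2. f e) + (\<Sum>u\<in>A. \<Sum>v\<in>B. f {u, v}) +
    (\<Sum>e | e \<subseteq> B \<and> card e = 2. f e)"
proof -
  let ?P = "\<lambda>C. {e. e \<subseteq> C \<and> card e = 2}" and ?M = "(\<lambda>(u, v). {u, v}) ` (A \<times> B)"
  have fin: "finite (?P A)" "finite (?P B)" "finite ?M"
    using assms by auto
  have "?P (A \<union> B) = (?P A \<union> ?M) \<union> ?P B"
  proof (intro equalityI subsetI)
    fix e assume "e \<in> ?P (A \<union> B)"
    then obtain u v where "e = {u, v}" "u \<noteq> v" "u \<in> A \<union> B" "v \<in> A \<union> B"
      by (auto simp: card_2_iff)
    then show "e \<in> (?P A \<union> ?M) \<union> ?P B"
      \<comment> \<open>If \<open>u\<close> lies in \<open>B\<close> and \<open>v\<close> in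
        \<open>A\<close>, the mixed pair is named in the wrong order and must be swapped.\<close>
      by (cases "u \<in> A"; cases "v \<in> A") (auto simp: insert_commute)
  next
    fix e assume "e \<in> (?P A \<union> ?M) \<union> ?P B"
    then show "e \<in> ?P (A \<union> B)"
      using assms(3) by (auto simp: card_2_iff) blast
  qed
  moreover have "?P A \<inter> ?M = {}" "(?P A \<union> ?M) \<inter> ?P B = {}"
    using assms(3) by (auto simp: card_2_iff)
  ultimately have "sum f (?P (A \<union> B)) = sum f (?P A) + sum f ?M + sum f (?P B)"
    using fin by (simp add: sum.union_disjoint)
  \<comment> \<open>The swapped solution of an equation of doubletons would put an element into both
    \<open>A\<close> and \<open>B\<close>.\<close>
  moreover have "inj_on (\<lambda>(u, v). {u, v}) (A \<times> B)"
    using assms(3) by (auto simp: inj_on_def doubleton_eq_iff)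
  then have "sum f ?M = (\<Sum>u\<in>A. \<Sum>v\<in>B. f {u, v})"
    by (simp add: sum.reindex sum.cartesian_product case_prod_unfold)
  ultimately show ?thesis
    by simp
qed

context pair_wf_digraph
begin

text \<open>Reduces distances to counting arcs: one walk gives an upper bound, a bound on all walks
  a lower one.\<close>

lemma awalk_cost_one: "awalk_cost (\<lambda>_. 1) p = real (length p)" for p :: "('a \<times> 'a) awalk"
  by (induction p) auto

lemma distance_le_length: "awalk u p v \<Longrightarrow> distance G u v \<le> ereal (real (length p))"
  using min_cost_le_walk_cost[of u p v "\<lambda>_. 1"] by (simp add: distance_def awalk_cost_one)

lemma distance_geI:
  assumes "\<And>p. awalk u p v \<Longrightarrow> k \<le> length p"
  shows "ereal (real k) \<le> distance G u v"
  unfolding distance_def \<mu>_def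
  by (rule INF_greatest) (use assms in \<open>simp add: awalk_cost_one\<close>)

lemma distance_eq_1:
  assumes "(u, v) \<in> parcs G" "u \<noteq> v"
  shows "distance G u v = 1"
proof (rule antisym)
  have "awalk u [(u, v)] v"
    using assms by (auto simp: awalk_Cons_iff awalk_Nil_iff in_arcsD2)
  from distance_le_length[OF this] show "distance G u v \<le> 1"
    by (simp add: one_ereal_def)
  have "1 \<le> length p" if "awalk u p v" for p
    using that assms(2) by (cases p) (auto simp: awalk_Nil_iff)
  from distance_geI[OF this] show "1 \<le> distance G u v"
    by (simp add: one_ereal_def)
qed

text \<open>The path through \<open>w\<close> has two arcs. A shorter walk is empty, forcing
  \<open>u = v\<close>, or is the single excluded arc from \<open>u\<close> to
  \<open>v\<close>.\<close>

lemma distance_eq_2: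
  assumes "(u, w) \<in> parcs G" "(w, v) \<in> parcs G" "u \<noteq> v" "(u, v) \<notin> parcs G"
  shows "distance G u v = 2"
proof (rule antisym)
  have "awalk u [(u, w), (w, v)] v"
    using assms by (auto simp: awalk_Cons_iff awalk_Nil_iff in_arcsD2)
  from distance_le_length[OF this] show "distance G u v \<le> 2"
    by simp
  have "2 \<le> length p" if p: "awalk u p v" for p
  proof (rule ccontr)
    assume "\<not> 2 \<le> length p"
    then have "length p = 0 \<or> length p = 1"
      by linarith
    then show False
      using p assms(3,4) by (auto simp: length_Suc_conv awalk_Cons_iff awalk_Nil_iff)
  qed
  from distance_geI[OF this] show "2 \<le> distance G u v"
    by simp
qed

end

lemma cyclic_group_generators_nonempty:
  assumes "cyclic_group G"
  shows "generators G \<noteq> {}"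
proof -
  obtain x where x: "x \<in> carrier G" "subgroup_generated G {x} = G"
    using assms by (auto simp: cyclic_group_def)
  \<comment> \<open>The carrier of \<open>subgroup_generated G {x}\<close> is generated by
    \<open>carrier G \<inter> {x}\<close>, which is \<open>{x}\<close> because \<open>x\<close> lies
    in the carrier.\<close>
  then have "carrier G = generate G {x}"
    using carrier_subgroup_generated[of G "{x}"] by simp
  with x(1) show ?thesis
    by (auto simp: generators_def)
qed

lemma generators_subset: "generators G \<subseteq> carrier G"
  by (auto simp: generators_def)

lemma pverts_generator_graph: "pverts (generator_graph G) = carrier G"
  by (simp add: generator_graph_def)

lemma parcs_generator_graph:
  "(x, y) \<in> parcs (generator_graph G) \<longleftrightarrow>
    x \<in> carrier G \<and> y \<in> carrier G \<and> x \<noteq> y \<and> (x \<in> generators G \<or> y \<in> generators G)"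
  by (auto simp: generator_graph_def generators_def)

lemma degree_eq_card_neighbours: "degree \<Gamma> v = card {w. (v, w) \<in> parcs \<Gamma>}"
proof -
  have "out_arcs (with_proj \<Gamma>) v = Pair v ` {w. (v, w) \<in> parcs \<Gamma>}"
    by (auto simp: out_arcs_def)
  then show ?thesis
    by (simp add: degree_def out_degree_def card_image inj_on_def)
qed

text \<open>The subtracted 1 is \<open>v\<close> itself, as there are no loops. For an infinite
  carrier both sides are 0 by convention.\<close>

lemma degree_generator:
  assumes "v \<in> generators G"
  shows "degree (generator_graph G) v = order G - 1"
proof -
  have "{w. (v, w) \<in> parcs (generator_graph G)} = carrier G - {v}"
    using assms generators_subset[of G] by (auto simp: parcs_generator_graph)
  with assms generators_subset[of G] show ?thesis
    by (auto simp: degree_eq_card_neighbours order_def card_Diff_singleton)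
qed

lemma degree_nongenerator:
  assumes "v \<in> carrier G - generators G"
  shows "degree (generator_graph G) v = card (generators G)"
proof -
  have "{w. (v, w) \<in> parcs (generator_graph G)} = generators G"
    using assms generators_subset[of G] by (auto simp: parcs_generator_graph)
  then show ?thesis
    by (simp add: degree_eq_card_neighbours)
qed

theorem theorem4p3:
  fixes G :: "('a, 'b) monoid_scheme" and n :: nat and S :: "'a set"
  assumes "group G" and "cyclic_group G" and "finite (carrier G)"
    and "\<not> trivial_group G"
    and "n = order G" and "S = generators G"
  shows "gutman_index (generator_graph G) =
    ereal (1 / 2 * real (card S) * (real (card S) - 1) * (real n - 1)\<^sup>2
      + (real (card S))\<^sup>2 * (real n - real (card S)) * (2 * real n - real (card S) - 2))"
proof -
  interpret \<Gamma>: pair_bidirected_digraph "generator_graph G"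
    by (rule pair_bidirected_generator_graph)
  define T where "T = carrier G - S"
  \<comment> \<open>Naming the summand as a function of the unordered pair lets the sum be split;
    symmetry of the graph then removes the description operator.\<close>
  define f where "f = (\<lambda>e. THE c. \<exists>u v. e = {u, v} \<and>
    c = ereal (degree (generator_graph G) u * degree (generator_graph G) v) *
      distance (generator_graph G) u v)"
  have f: "f {u, v} = ereal (degree (generator_graph G) u * degree (generator_graph G) v) *
      distance (generator_graph G) u v" for u v
    unfolding f_def by (rule \<Gamma>.gutman_summand)
  have S: "S \<subseteq> carrier G"
    using assms(6) generators_subset by simp
  obtain g where g: "g \<in> S"
    using assms(2,6) cyclic_group_generators_nonempty by blast
  have fin: "finite S" "finite T" and ST: "S \<inter> T = {}" and un: "S \<union> T = carrier G"
    using assms(3) S by (auto simp: T_def intro: finite_subset)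
  have n: "n = card S + card T"
    unfolding assms(5) order_def un[symmetric] by (rule card_Un_disjoint[OF fin ST])
  \<comment> \<open>This gives \<open>n \<ge> 1\<close>, so the natural-number degree
    \<open>n - 1\<close> does not truncate when cast to the reals.\<close>
  have "card S \<noteq> 0"
    using g fin by auto
  then have n1: "real (n - Suc 0) = real n - 1"
    using n by simp
  have deg_S: "degree (generator_graph G) v = n - 1" if "v \<in> S" for v
    using that assms(5,6) degree_generator by simp
  have deg_T: "degree (generator_graph G) v = card S" if "v \<in> T" for v
    using that assms(6) degree_nongenerator by (simp add: T_def)
  \<comment> \<open>With \<open>v\<close> anywhere in the carrier, this serves the pairs inside
    \<open>S\<close> as well as the mixed ones.\<close>
  have dist_S: "distance (generator_graph G) u v = 1" if "u \<in> S" "v \<in> carrier G" "u \<noteq> v" for u v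
    by (rule \<Gamma>.distance_eq_1) (use that S assms(6) in \<open>auto simp: parcs_generator_graph\<close>)
  \<comment> \<open>The generator \<open>g\<close> is the middle vertex of a path between two
    non-adjacent non-generators.\<close>
  have dist_T: "distance (generator_graph G) u v = 2" if "u \<in> T" "v \<in> T" "u \<noteq> v" for u v
    by (rule \<Gamma>.distance_eq_2[of _ g])
      (use that S g assms(6) in \<open>auto simp: parcs_generator_graph T_def\<close>)
  have pairs: "(\<Sum>e | e \<subseteq> A \<and> card e = 2. f e) = ereal (real (card A choose 2) * c)"
    if "finite A" "\<And>u v. u \<in> A \<Longrightarrow> v \<in> A \<Longrightarrow> u \<noteq> v \<Longrightarrow> f {u, v} = ereal c" for A c
  proof -
    have "(\<Sum>e | e \<subseteq> A \<and> card e = 2. f e) = (\<Sum>e | e \<subseteq> A \<and> card e = 2. ereal c)"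
      by (rule sum.cong) (use that(2) in \<open>auto simp: card_2_iff\<close>)
    then show ?thesis
      by (simp add: n_subsets that(1))
  qed
  have "gutman_index (generator_graph G) = (\<Sum>e | e \<subseteq> S \<union> T \<and> card e = 2. f e)"
    by (simp add: gutman_index_def f_def pverts_generator_graph un)
  also have "\<dots> = (\<Sum>e | e \<subseteq> S \<and> card e = 2. f e) + (\<Sum>u\<in>S. \<Sum>v\<in>T. f {u, v}) +
      (\<Sum>e | e \<subseteq> T \<and> card e = 2. f e)"
    by (rule sum_pairs_Un_disjoint[OF fin ST])
  also have "(\<Sum>e | e \<subseteq> S \<and> card e = 2. f e) = ereal (real (card S choose 2) * (real n - 1)\<^sup>2)"
    by (rule pairs[OF fin(1)]) (use S in \<open>auto simp: f deg_S dist_S n1 power2_eq_square subsetD\<close>)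
  \<comment> \<open>The factor 2 is the distance, the square the product of the two degrees.\<close>
  also have "(\<Sum>e | e \<subseteq> T \<and> card e = 2. f e) = ereal (real (card T choose 2) * (2 * (real (card S))\<^sup>2))"
    by (rule pairs[OF fin(2)]) (simp add: f deg_T dist_T power2_eq_square numeral_eq_ereal)
  also have "(\<Sum>u\<in>S. \<Sum>v\<in>T. f {u, v}) = (\<Sum>u\<in>S. \<Sum>v\<in>T. ereal ((real n - 1) * real (card S)))"
    by (intro sum.cong refl) (use ST un in \<open>subst f; subst dist_S; auto simp: deg_S deg_T n1\<close>)
  also have "\<dots> = ereal (real (card S) * real (card T) * ((real n - 1) * real (card S)))"
    by simp
  \<comment> \<open>The mixed and outer sums share the factor \<open>(card S)^2 * card T\<close>;
    their cofactors \<open>n - 1\<close> and \<open>card T - 1\<close> add up to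
    \<open>2 * n - card S - 2\<close>, since \<open>card T = n - card S\<close>.\<close>
  finally show ?thesis
    by (simp add: real_choose_two n power2_eq_square field_simps)
qed

end
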